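(* Let $\mathcal{T}=\{T_m\}_{m=1}^M$ be a decision tree ensemble on $\mathcal{X}\subseteq\mathbb{R}^p$ with classes $\{1,\dots,C\}$ and original weights $\bm{w}^{(0)}\in\mathbb{R}_{\ge 0}^M$, let $s:\mathcal{X}\to\mathbb{R}$ be a score function, and let $\alpha\in(0,1)$. Let $\mathcal{D}_{\mathrm{cal}}=\{\bm{X}_1,\dots,\bm{X}_n\}$ be the calibration inputs and $\bm{X}_{\mathrm{new}}$ a future input, all taking values in $\mathcal{X}$. Assume that $\bm{X}_1,\dots,\bm{X}_n,\bm{X}_{\mathrm{new}}$ all follow the same distribution $P_0$ and are exchangeable (their joint distribution is invariant under permutations). Let $\tau(\alpha)$ be the split conformal threshold computed from $s(\bm{X}_1),\dots,s(\bm{X}_n)$, and let $\bm{w}$ be the pruned weight vector returned by PINE run with $\mathcal{T}$, $\bm{w}^{(0)}$, $s$ and $\tau(\alpha)$, where every Oracle call is solved exactly. Then $$\mathbb{P}\left[\hat{y}(\bm{X}_{\mathrm{new}};\bm{w})=\hat{y}(\bm{X}_{\mathrm{new}};\bm{w}^{(0)})\right]\ge 1-\alpha,$$ where the probability is over the joint draw of the calibration set and the future input.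
   Context: Tree ensemble. Each tree $T_m$ has a finite leaf set $\mathcal{L}_m$, a leaf map $\lambda_m:\mathcal{X}\to\mathcal{L}_m$ sending each input to the leaf it reaches (obtained from finitely many axis-aligned threshold splits), and a constant score vector $\bm{v}_{m,\ell}\in\mathbb{R}^C$ for each leaf $\ell\in\mathcal{L}_m$. For weights $\bm{w}\in\mathbb{R}_{\ge 0}^M$, the ensemble score is $\bm{F}(\bm{x};\bm{w})=\sum_{m=1}^M w_m\,\bm{v}_{m,\lambda_m(\bm{x})}\in\mathbb{R}^C$, and the predicted class is $\hat{y}(\bm{x};\bm{w})=\operatorname{argmax}_{c\in\{1,\dots,C\}}[\bm{F}(\bm{x};\bm{w})]_c$, with ties broken by the smallest class index. Fit set. A finite set $\mathcal{D}_{\mathrm{fit}}\subseteq\mathcal{X}$, disjoint from the calibration data, is used to train the ensemble $(\mathcal{T},\bm{w}^{(0)})$ and to fit the (measurable) score function $s$. It is treated as fixed, so $\mathcal{T}$, $\bm{w}^{(0)}$ and $s$ are non-random. Split conformal threshold. Let $s_{(1)}\le\dots\le s_{(n)}$ be the order statistics of $s(\bm{X}_1),\dots,s(\bm{X}_n)$ and $k=\lceil (n+1)(1-\alpha)\rceil$. Set $\tau(\alpha)=s_{(k)}$ if $k\le n$, and $\tau(\alpha)=+\infty$ if $k=n+1$. The in-distribution region is $\mathcal{X}_{\mathrm{ID}}(\alpha)=\{\bm{x}\in\mathcal{X}: s(\bm{x})\le\tau(\alpha)\}$. PINE algorithm. Start from $\mathcal{S}^{(0)}=\mathcal{D}_{\mathrm{fit}}$.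 At iteration $t$: (1) Pruner returns a weight vector $\bm{w}\in\mathbb{R}_{\ge0}^M$ minimizing $\|\bm{w}\|_0$ (the number of non-zero entries) subject to $\hat{y}(\bm{x};\bm{w})=\hat{y}(\bm{x};\bm{w}^{(0)})$ for all $\bm{x}\in\mathcal{S}^{(t)}$. (2) Oracle returns a finite set $\mathcal{S}^\star$ of counterexamples in the in-distribution region, i.e. points $\bm{x}\in\mathcal{X}_{\mathrm{ID}}(\alpha)$ with $\hat{y}(\bm{x};\bm{w})\neq\hat{y}(\bm{x};\bm{w}^{(0)})$. The Oracle being solved exactly means that it returns $\mathcal{S}^\star=\varnothing$ if and only if no such point exists. If $\mathcal{S}^\star\neq\varnothing$, set $\mathcal{S}^{(t+1)}=\mathcal{S}^{(t)}\cup\mathcal{S}^\star$ and continue with iteration $t+1$; if $\mathcal{S}^\star=\varnothing$, stop and return the current $\bm{w}$. The returned $\bm{w}$ is a random vector depending on the calibration data through $\tau(\alpha)$; it is assumed to be measurable. *)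

theory Defs
  imports "HOL-Probability.Probability" "HOL-Combinatorics.Permutations"
begin

text \<open>
  Inputs are vectors of type \<open>real ^ 'p\<close>, the trees of an ensemble are indexed by the finite
  type \<open>'m\<close>, and the classes \<open>1, \<dots>, C\<close> are the elements of a finite linearly ordered type
  \<open>'c\<close>, so that score vectors have type \<open>real ^ 'c\<close> and weights have type \<open>real ^ 'm\<close>.
\<close>

section \<open>Tree ensembles\<close>

text \<open>
  Both usual conventions for threshold splits are allowed: a point \<open>x\<close> goes to the left subtree
  iff \<open>x $ j \<le> \<theta>\<close> (\<open>Split_le\<close>), respectively iff \<open>x $ j < \<theta>\<close> (\<open>Split_less\<close>). The leaf set
  of a tree is given by \<open>leaf_set\<close>.
\<close>

datatype ('p, leaf_set: 'l) dtree =
    Leaf 'l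
  | Split_le 'p real "('p, 'l) dtree" "('p, 'l) dtree"
  | Split_less 'p real "('p, 'l) dtree" "('p, 'l) dtree"

primrec leaf_map :: "('p::finite, 'l) dtree \<Rightarrow> real ^ 'p \<Rightarrow> 'l" where
  "leaf_map (Leaf l) x = l"
| "leaf_map (Split_le j \<theta> t1 t2) x = (if x $ j \<le> \<theta> then leaf_map t1 x else leaf_map t2 x)"
| "leaf_map (Split_less j \<theta> t1 t2) x = (if x $ j < \<theta> then leaf_map t1 x else leaf_map t2 x)"

definition ensemble_score ::
  "('m::finite \<Rightarrow> ('p::finite, 'l) dtree) \<Rightarrow> ('m \<Rightarrow> 'l \<Rightarrow> real ^ 'c::finite)
    \<Rightarrow> real ^ 'm \<Rightarrow> real ^ 'p \<Rightarrow> real ^ 'c"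
where
  "ensemble_score T v w x = (\<Sum>m\<in>UNIV. (w $ m) *\<^sub>R v m (leaf_map (T m) x))"

definition predicted_class ::
  "('m::finite \<Rightarrow> ('p::finite, 'l) dtree) \<Rightarrow> ('m \<Rightarrow> 'l \<Rightarrow> real ^ 'c::{finite,linorder})
    \<Rightarrow> real ^ 'm \<Rightarrow> real ^ 'p \<Rightarrow> 'c"
where
  "predicted_class T v w x =
    Min {c. \<forall>d. ensemble_score T v w x $ d \<le> ensemble_score T v w x $ c}"

section \<open>Split conformal threshold\<close>

text \<open>
  The list argument contains the calibration scores, with repetitions. The index into the sorted
  list is shifted because lists are indexed from \<open>0\<close>. For \<open>0 < \<alpha> < 1\<close> the second branch is taken
  exactly when \<open>k = n + 1\<close>.
\<close>

definition conformal_threshold :: "real \<Rightarrow> real list \<Rightarrow> ereal" where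
  "conformal_threshold \<alpha> scores =
    (let n = length scores; k = nat \<lceil>(real n + 1) * (1 - \<alpha>)\<rceil>
     in if k \<le> n then ereal (sort scores ! (k - 1)) else \<infinity>)"

definition id_region :: "(real ^ 'p::finite) set \<Rightarrow> (real ^ 'p \<Rightarrow> real) \<Rightarrow> ereal \<Rightarrow> (real ^ 'p) set" where
  "id_region \<X> s \<tau> = {x \<in> \<X>. ereal (s x) \<le> \<tau>}"

section \<open>The PINE algorithm\<close>

definition l0_norm :: "real ^ 'm::finite \<Rightarrow> nat" where
  "l0_norm w = card {m. w $ m \<noteq> 0}"

definition pruner_feasible ::
  "('m::finite \<Rightarrow> ('p::finite, 'l) dtree) \<Rightarrow> ('m \<Rightarrow> 'l \<Rightarrow> real ^ 'c::{finite,linorder})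
    \<Rightarrow> real ^ 'm \<Rightarrow> (real ^ 'p) set \<Rightarrow> real ^ 'm \<Rightarrow> bool"
where
  "pruner_feasible T v w0 S w \<longleftrightarrow>
    (\<forall>m. 0 \<le> w $ m) \<and> (\<forall>x\<in>S. predicted_class T v w x = predicted_class T v w0 x)"

definition pruner_output ::
  "('m::finite \<Rightarrow> ('p::finite, 'l) dtree) \<Rightarrow> ('m \<Rightarrow> 'l \<Rightarrow> real ^ 'c::{finite,linorder})
    \<Rightarrow> real ^ 'm \<Rightarrow> (real ^ 'p) set \<Rightarrow> real ^ 'm \<Rightarrow> bool"
where
  "pruner_output T v w0 S w \<longleftrightarrow> is_arg_min l0_norm (pruner_feasible T v w0 S) w"

definition counterexamples ::
  "('m::finite \<Rightarrow> ('p::finite, 'l) dtree) \<Rightarrow> ('m \<Rightarrow> 'l \<Rightarrow> real ^ 'c::{finite,linorder})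
    \<Rightarrow> real ^ 'm \<Rightarrow> (real ^ 'p) set \<Rightarrow> real ^ 'm \<Rightarrow> (real ^ 'p) set"
where
  "counterexamples T v w0 R w =
    {x \<in> R. predicted_class T v w x \<noteq> predicted_class T v w0 x}"

definition exact_oracle_output ::
  "('m::finite \<Rightarrow> ('p::finite, 'l) dtree) \<Rightarrow> ('m \<Rightarrow> 'l \<Rightarrow> real ^ 'c::{finite,linorder})
    \<Rightarrow> real ^ 'm \<Rightarrow> (real ^ 'p) set \<Rightarrow> real ^ 'm \<Rightarrow> (real ^ 'p) set \<Rightarrow> bool"
where
  "exact_oracle_output T v w0 R w S' \<longleftrightarrow>
    finite S' \<and> S' \<subseteq> counterexamples T v w0 R w \<and>
    (S' = {} \<longleftrightarrow> counterexamples T v w0 R w = {})"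

text \<open>
  \<open>pine T v w0 R S w\<close>: some run of the iteration with in-distribution region \<open>R\<close>, started with
  the constraint set \<open>S\<close>, stops and returns \<open>w\<close>. It is a relation because neither the minimizer
  chosen by the Pruner nor the counterexamples chosen by the Oracle are unique.
\<close>

inductive pine ::
  "('m::finite \<Rightarrow> ('p::finite, 'l) dtree) \<Rightarrow> ('m \<Rightarrow> 'l \<Rightarrow> real ^ 'c::{finite,linorder})
    \<Rightarrow> real ^ 'm \<Rightarrow> (real ^ 'p) set \<Rightarrow> (real ^ 'p) set \<Rightarrow> real ^ 'm \<Rightarrow> bool"
  for T v w0 R
where
  stop: "pine T v w0 R S w"
    if "pruner_output T v w0 S w" "exact_oracle_output T v w0 R w {}"
| continue: "pine T v w0 R S w'"
    if "pruner_output T v w0 S w" "exact_oracle_output T v w0 R w S'" "S' \<noteq> {}"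
      "pine T v w0 R (S \<union> S') w'"

section \<open>Exchangeability\<close>

definition exchangeable :: "'a measure \<Rightarrow> 'b measure \<Rightarrow> 'i set \<Rightarrow> ('i \<Rightarrow> 'a \<Rightarrow> 'b) \<Rightarrow> bool" where
  "exchangeable M N I Z \<longleftrightarrow>
    (\<forall>\<pi>. \<pi> permutes I \<longrightarrow>
      distr M (\<Pi>\<^sub>M i\<in>I. N) (\<lambda>\<omega>. \<lambda>i\<in>I. Z (\<pi> i) \<omega>) =
      distr M (\<Pi>\<^sub>M i\<in>I. N) (\<lambda>\<omega>. \<lambda>i\<in>I. Z i \<omega>))"

end

theory Submission
  imports Defs
begin

text \<open>
  When PINE stops, the last Oracle call certifies that no counterexample is left in the
  in-distribution region, so agreement can only fail if \<open>s X_new > \<tau>\<close>. That event is controlled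
  by a rank argument: with \<open>k = \<lceil>(n + 1) (1 - \<alpha>)\<rceil>\<close>, at least \<open>k\<close> of the \<open>n + 1\<close> scores have fewer
  than \<open>k\<close> scores strictly below them, and by exchangeability each of them is equally likely to be
  among these; hence \<open>X_new\<close> is with probability at least \<open>k / (n + 1) \<ge> 1 - \<alpha>\<close>. Using strict
  ranks makes the argument valid in the presence of ties.
\<close>

text \<open>Only \<open>stop\<close> produces an output, and its empty Oracle answer is exact;
  \<open>continue\<close> enlarges \<open>S\<close> but leaves \<open>R\<close> fixed, so the claim
  passes through.\<close>

lemma pine_no_counterexamples:
  assumes "pine T v w0 R S w"
  shows "counterexamples T v w0 R w = {}"
  using assms by induction (auto simp: exact_oracle_output_def)

text \<open>Among the indices of strict rank at least \<open>k\<close>, take one with minimal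
  \<open>f\<close>-value: at least \<open>k\<close> indices lie strictly below it, and by minimality
  all of them have rank below \<open>k\<close>. If no such index exists, all of \<open>I\<close>
  counts.\<close>

lemma card_low_rank_ge:
  fixes f :: "'i \<Rightarrow> 'b::linorder"
  assumes "finite I" "k \<le> card I"
  shows "k \<le> card {j \<in> I. card {i \<in> I. f i < f j} < k}"
proof (cases "{j \<in> I. k \<le> card {i \<in> I. f i < f j}} = {}")
  case True
  then have "{j \<in> I. card {i \<in> I. f i < f j} < k} = I"
    by (auto simp: not_le)
  then show ?thesis
    using assms by simp
next
  case False
  define j where "j = arg_min_on f {j \<in> I. k \<le> card {i \<in> I. f i < f j}}"
  have j: "k \<le> card {i \<in> I. f i < f j}"
    using arg_min_if_finite(1)[OF _ False, of f] assms(1) by (auto simp: j_def)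
  have "{i \<in> I. f i < f j} \<subseteq> {j \<in> I. card {i \<in> I. f i < f j} < k}"
    using arg_min_if_finite(2)[OF _ False, of f] assms(1) by (auto simp: j_def not_le[symmetric])
  then have "card {i \<in> I. f i < f j} \<le> card {j \<in> I. card {i \<in> I. f i < f j} < k}"
    using assms(1) by (intro card_mono) auto
  then show ?thesis
    using j by simp
qed

lemma card_less_of_sort_nth_less:
  fixes xs :: "'b::linorder list"
  assumes "0 < k" "k \<le> length xs" "sort xs ! (k - 1) < y"
  shows "k \<le> card {i. i < length xs \<and> xs ! i < y}"
proof -
  have "sort xs ! i < y" if "i < k" for i
  proof -
    have "sort xs ! i \<le> sort xs ! (k - 1)"
      using that assms(2) by (intro sorted_nth_mono) auto
    then show ?thesis
      using assms(3) by order
  qed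
  then have "{..<k} \<subseteq> {i. i < length (sort xs) \<and> sort xs ! i < y}"
    using assms(2) by auto
  then have "card {..<k} \<le> card {i. i < length (sort xs) \<and> sort xs ! i < y}"
    by (intro card_mono) auto
  \<comment> \<open>The length of the filtered list depends only on the multiset of entries, so the
    count carries over from \<open>sort xs\<close> to \<open>xs\<close>.\<close>
  also have "\<dots> = length (filter (\<lambda>x. x < y) (sort xs))"
    by (simp add: length_filter_conv_card)
  also have "\<dots> = length (filter (\<lambda>x. x < y) xs)"
    by (metis mset_filter mset_sort size_mset)
  also have "\<dots> = card {i. i < length xs \<and> xs ! i < y}"
    by (simp add: length_filter_conv_card)
  finally show ?thesis
    by simp
qed

text \<open>By contraposition: a value above the threshold forces the finite branch, hence exceeds
  the \<open>k\<close>-th order statistic and has at least \<open>k\<close> scores strictly below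
  it.\<close>

lemma le_conformal_thresholdI:
  fixes f :: "nat \<Rightarrow> real"
  assumes "\<alpha> < 1" "card {i \<in> {1..n}. f i < y} < nat \<lceil>(real n + 1) * (1 - \<alpha>)\<rceil>"
  shows "ereal y \<le> conformal_threshold \<alpha> (map f [1..<n + 1])"
proof (rule ccontr)
  define k where "k = nat \<lceil>(real n + 1) * (1 - \<alpha>)\<rceil>"
  let ?xs = "map f [1..<n + 1]"
  assume "\<not> ?thesis"
  then have "k \<le> length ?xs" "sort ?xs ! (k - 1) < y"
    by (auto simp: conformal_threshold_def Let_def k_def simp del: upt_Suc split: if_splits)
  \<comment> \<open>This rules out truncation in the natural-number index
    \<open>k - 1\<close>.\<close>
  moreover have "0 < k"
    using assms(1) by (simp add: k_def)
  ultimately have "k \<le> card {i. i < length ?xs \<and> ?xs ! i < y}"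
    by (intro card_less_of_sort_nth_less)
  \<comment> \<open>List position \<open>i\<close> holds the score with index
    \<open>Suc i\<close>.\<close>
  also have "\<dots> = card {i. i < n \<and> f (Suc i) < y}"
    by (intro arg_cong[where f = card]) (auto simp del: upt_Suc)
  also have "\<dots> = card (Suc ` {i. i < n \<and> f (Suc i) < y})"
    by (simp add: card_image)
  also have "Suc ` {i. i < n \<and> f (Suc i) < y} = {i \<in> {1..n}. f i < y}"
    by (auto simp: image_iff) (metis Suc_le_D Suc_le_lessD)
  finally show False
    using assms(2) unfolding k_def by linarith
qed

text \<open>Double counting: at every outcome at least \<open>k\<close> of the events
  \<open>B l\<close> occur, so their probabilities sum to at least \<open>k\<close>; exchangeability
  makes all of them equal to \<open>prob (B j)\<close>.\<close>

lemma (in prob_space) prob_low_rank_ge: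
  fixes f :: "'b \<Rightarrow> real" and Z :: "'i \<Rightarrow> 'a \<Rightarrow> 'b"
  assumes "finite I" "k \<le> card I" "j \<in> I"
    and Z[measurable]: "\<And>i. i \<in> I \<Longrightarrow> Z i \<in> measurable M N"
    and f[measurable]: "f \<in> borel_measurable N"
    and exch: "exchangeable M N I Z"
  shows "real k / real (card I) \<le> prob {\<omega> \<in> space M. card {i \<in> I. f (Z i \<omega>) < f (Z j \<omega>)} < k}"
proof -
  define B where "B l = {\<omega> \<in> space M. card {i \<in> I. f (Z i \<omega>) < f (Z l \<omega>)} < k}" for l
  define A where "A = {z \<in> space (\<Pi>\<^sub>M i\<in>I. N). card {i \<in> I. f (z i) < f (z j)} < k}"
  \<comment> \<open>Written as a finite sum of indicators, the rank is visibly measurable in the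
    outcome.\<close>
  have card_eq: "card {i \<in> I. P i} = (\<Sum>i\<in>I. if P i then 1 else 0)" for P
    using \<open>finite I\<close> by (simp add: sum.If_cases Int_def)
  have B_sets: "B l \<in> sets M" if [measurable]: "l \<in> I" for l
    unfolding B_def card_eq by measurable
  have A_sets: "A \<in> sets (\<Pi>\<^sub>M i\<in>I. N)"
    unfolding A_def card_eq using \<open>j \<in> I\<close> by measurable
  have B_eq: "prob (B l) = prob (B j)" if l: "l \<in> I" for l
  proof -
    \<comment> \<open>Swapping \<open>j\<close> and \<open>l\<close> turns the event that coordinate
      \<open>j\<close> has low rank into \<open>B l\<close>, since permuting the other values does
      not change a count.\<close>
    define \<pi> where "\<pi> = Transposition.transpose j l"
    have \<pi>: "\<pi> permutes I"
      unfolding \<pi>_def using \<open>j \<in> I\<close> l by (intro permutes_swap_id)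
    have perm_meas: "(\<lambda>\<omega>. \<lambda>i\<in>I. Z (\<sigma> i) \<omega>) \<in> measurable M (\<Pi>\<^sub>M i\<in>I. N)" if "\<sigma> permutes I" for \<sigma>
      using permutes_in_image[OF that] by (intro measurable_restrict) auto
    have vimage: "(\<lambda>\<omega>. \<lambda>i\<in>I. Z (\<sigma> i) \<omega>) -` A \<inter> space M = B (\<sigma> j)" if \<sigma>: "\<sigma> permutes I" for \<sigma>
    proof -
      have "card {i \<in> I. f (Z (\<sigma> i) \<omega>) < f (Z (\<sigma> j) \<omega>)} =
          card {i \<in> I. f (Z i \<omega>) < f (Z (\<sigma> j) \<omega>)}" for \<omega>
      proof -
        let ?r = "f (Z (\<sigma> j) \<omega>)"
        have "card {i \<in> I. f (Z (\<sigma> i) \<omega>) < ?r} = card (\<sigma> ` {i \<in> I. f (Z (\<sigma> i) \<omega>) < ?r})"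
          by (rule card_image[symmetric]) (rule permutes_inj_on[OF \<sigma>])
        also have "\<sigma> ` {i \<in> I. f (Z (\<sigma> i) \<omega>) < ?r} = {i \<in> \<sigma> ` I. f (Z i \<omega>) < ?r}"
          by auto
        finally show ?thesis
          by (simp only: permutes_image[OF \<sigma>])
      qed
      moreover have "{i \<in> I. f ((\<lambda>i\<in>I. Z (\<sigma> i) \<omega>) i) < f ((\<lambda>i\<in>I. Z (\<sigma> i) \<omega>) j)} =
          {i \<in> I. f (Z (\<sigma> i) \<omega>) < f (Z (\<sigma> j) \<omega>)}" for \<omega>
        using \<open>j \<in> I\<close> by auto
      ultimately show ?thesis
        using measurable_space[OF perm_meas[OF \<sigma>]] by (auto simp: A_def B_def)
    qed
    have "prob (B (\<pi> j)) = measure (distr M (\<Pi>\<^sub>M i\<in>I. N) (\<lambda>\<omega>. \<lambda>i\<in>I. Z (\<pi> i) \<omega>)) A"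
      using measure_distr[OF perm_meas[OF \<pi>] A_sets] vimage[OF \<pi>] by simp
    \<comment> \<open>The unpermuted tuple is written with \<open>id\<close>, so that
      \<open>vimage\<close> applies to both sides.\<close>
    also have "\<dots> = measure (distr M (\<Pi>\<^sub>M i\<in>I. N) (\<lambda>\<omega>. \<lambda>i\<in>I. Z (id i) \<omega>)) A"
      using exch \<pi> by (simp add: exchangeable_def)
    also have "\<dots> = prob (B (id j))"
      using measure_distr[OF perm_meas[OF permutes_id] A_sets] vimage[OF permutes_id] by simp
    finally show ?thesis
      by (simp add: \<pi>_def)
  qed
  have [simp]: "integrable M (indicator (B l) :: _ \<Rightarrow> real)" if "l \<in> I" for l
    using B_sets[OF that] by (intro integrable_real_indicator) (simp_all add: less_top[symmetric])
  have "real k = expectation (\<lambda>_. real k)"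
    by (simp add: prob_space)
  also have "\<dots> \<le> expectation (\<lambda>\<omega>. \<Sum>l\<in>I. indicator (B l) \<omega>)"
  proof (rule integral_mono)
    fix \<omega> assume "\<omega> \<in> space M"
    then have "(\<Sum>l\<in>I. indicator (B l) \<omega> :: real) =
        real (card {l \<in> I. card {i \<in> I. f (Z i \<omega>) < f (Z l \<omega>)} < k})"
      using \<open>finite I\<close> by (simp add: indicator_def B_def sum.If_cases Int_def)
    then show "real k \<le> (\<Sum>l\<in>I. indicator (B l) \<omega>)"
      using card_low_rank_ge[OF assms(1,2), of "\<lambda>i. f (Z i \<omega>)"] by simp
  qed simp_all
  also have "\<dots> = (\<Sum>l\<in>I. prob (B l))"
    using B_sets by simp
  also have "\<dots> = real (card I) * prob (B j)"
    using B_eq by simp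
  finally have "real k \<le> real (card I) * prob (B j)" .
  moreover have "0 < card I"
    using assms(1,3) by (auto simp: card_gt_0_iff)
  ultimately show ?thesis
    by (simp add: B_def field_simps)
qed

text \<open>The discrete target makes any assignment of score vectors to leaves measurable after
  composition.\<close>

lemma measurable_leaf_map[measurable]:
  "leaf_map t \<in> measurable borel (count_space UNIV)"
  by (induction t) (simp_all add: measurable_If_set, measurable)

lemma measurable_ensemble_score:
  assumes [measurable]: "W \<in> borel_measurable M" "Y \<in> borel_measurable M"
  shows "(\<lambda>\<omega>. ensemble_score T v (W \<omega>) (Y \<omega>) $ c) \<in> borel_measurable M"
proof -
  have [measurable]: "(\<lambda>\<omega>. v m (leaf_map (T m) (Y \<omega>)) $ c) \<in> borel_measurable M" for m
    by (rule measurable_compose[where N = "count_space UNIV" and g = "\<lambda>l. v m l $ c"]) measurable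
  have [measurable]: "(\<lambda>\<omega>. W \<omega> $ m) \<in> borel_measurable M" for m
    by (rule borel_measurable_continuous_on[OF _ assms(1)]) (intro continuous_intros)
  show ?thesis
    by (simp add: ensemble_score_def)
qed

lemma measurable_predicted_class:
  assumes [measurable]: "W \<in> borel_measurable M" "Y \<in> borel_measurable M"
  shows "(\<lambda>\<omega>. predicted_class T v (W \<omega>) (Y \<omega>)) \<in> measurable M (count_space UNIV)"
proof -
  note [measurable] = measurable_ensemble_score
  let ?A = "\<lambda>\<omega>. {c. \<forall>d. ensemble_score T v (W \<omega>) (Y \<omega>) $ d \<le> ensemble_score T v (W \<omega>) (Y \<omega>) $ c}"
  \<comment> \<open>The set of maximizing classes takes finitely many values, so measurability of
    each fibre suffices; \<open>Min\<close> is then applied on a discrete space.\<close>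
  have "Measurable.pred M (\<lambda>\<omega>. ?A \<omega> = C)" for C
    unfolding set_eq_iff mem_Collect_eq by measurable
  then have "?A \<in> measurable M (count_space UNIV)"
    by (subst measurable_count_space_eq2) (auto simp: pred_def vimage_def Int_def conj_commute)
  from measurable_compose[OF this, of Min] show ?thesis
    by (simp add: predicted_class_def)
qed

theorem proposition4p2:
  fixes \<X> :: "(real ^ 'p::finite) set"
    and T :: "'m::finite \<Rightarrow> ('p, 'l) dtree"
    and v :: "'m \<Rightarrow> 'l \<Rightarrow> real ^ 'c::{finite,linorder}"
    and w0 :: "real ^ 'm"
    and D_fit :: "(real ^ 'p) set"
    and s :: "real ^ 'p \<Rightarrow> real"
    and \<alpha> :: real
    and M :: "'a measure"
    and P0 :: "(real ^ 'p) measure"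
    and n :: nat
    and X :: "nat \<Rightarrow> 'a \<Rightarrow> real ^ 'p"
    and X_new :: "'a \<Rightarrow> real ^ 'p"
    and \<tau> :: "'a \<Rightarrow> ereal"
    and w :: "ereal \<Rightarrow> real ^ 'm"
  assumes w0_nonneg: "\<And>m. 0 \<le> w0 $ m"
    and fit: "finite D_fit" "D_fit \<subseteq> \<X>"
    and s_measurable: "s \<in> borel_measurable (restrict_space borel \<X>)"
    and alpha: "0 < \<alpha>" "\<alpha> < 1"
    and prob_M: "prob_space M"
    and X_measurable: "\<And>i. i \<in> {1..n} \<Longrightarrow> X i \<in> measurable M (restrict_space borel \<X>)"
    and X_new_measurable: "X_new \<in> measurable M (restrict_space borel \<X>)"
    and X_distr: "\<And>i. i \<in> {1..n} \<Longrightarrow> distr M (restrict_space borel \<X>) (X i) = P0"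
    and X_new_distr: "distr M (restrict_space borel \<X>) X_new = P0"
    and exch: "exchangeable M (restrict_space borel \<X>) {1..n + 1} (X(n + 1 := X_new))"
    and tau_def: "\<And>\<omega>. \<tau> \<omega> = conformal_threshold \<alpha> (map (\<lambda>i. s (X i \<omega>)) [1..<n + 1])"
    and w_returned: "\<And>\<omega>. \<omega> \<in> space M \<Longrightarrow> pine T v w0 (id_region \<X> s (\<tau> \<omega>)) D_fit (w (\<tau> \<omega>))"
    and w_measurable: "(\<lambda>\<omega>. w (\<tau> \<omega>)) \<in> borel_measurable M"
  shows "measure M {\<omega> \<in> space M.
           predicted_class T v (w (\<tau> \<omega>)) (X_new \<omega>) = predicted_class T v w0 (X_new \<omega>)}
         \<ge> 1 - \<alpha>"
proof -
  interpret prob_space M by (fact prob_M)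
  define k where "k = nat \<lceil>(real n + 1) * (1 - \<alpha>)\<rceil>"
  define Z where "Z = X(n + 1 := X_new)"
  let ?N = "restrict_space borel \<X>"
  let ?good = "{\<omega> \<in> space M.
    predicted_class T v (w (\<tau> \<omega>)) (X_new \<omega>) = predicted_class T v w0 (X_new \<omega>)}"
  let ?low = "{\<omega> \<in> space M. card {i \<in> {1..n + 1}. s (Z i \<omega>) < s (Z (n + 1) \<omega>)} < k}"
  have "(real n + 1) * (1 - \<alpha>) \<le> real (n + 1)"
    using alpha mult_left_le[of "1 - \<alpha>" "real n + 1"] by linarith
  then have k_le: "k \<le> n + 1"
    by (simp add: k_def nat_le_iff ceiling_le_iff)
  have Z_meas: "Z i \<in> measurable M ?N" if "i \<in> {1..n + 1}" for i
    using that X_measurable X_new_measurable by (auto simp: Z_def)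
  have "1 - \<alpha> \<le> real k / real (n + 1)"
    using real_nat_ceiling_ge[of "(real n + 1) * (1 - \<alpha>)"]
    by (simp add: k_def field_simps)
  also have "\<dots> \<le> prob ?low"
    using prob_low_rank_ge[of "{1..n + 1}" k "n + 1" Z ?N s] k_le Z_meas s_measurable exch
    by (simp add: Z_def)
  also have "\<dots> \<le> prob ?good"
  proof (rule finite_measure_mono)
    show "?low \<subseteq> ?good"
    proof safe
      fix \<omega> assume \<omega>: "\<omega> \<in> space M"
        and low: "card {i \<in> {1..n + 1}. s (Z i \<omega>) < s (Z (n + 1) \<omega>)} < k"
      \<comment> \<open>The future score is not strictly below itself, so its rank among all
        \<open>n + 1\<close> scores counts calibration scores only.\<close>
      have "{i \<in> {1..n + 1}. s (Z i \<omega>) < s (Z (n + 1) \<omega>)} = {i \<in> {1..n}. s (X i \<omega>) < s (X_new \<omega>)}"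
        by (auto simp: Z_def le_Suc_eq)
      then have "ereal (s (X_new \<omega>)) \<le> \<tau> \<omega>"
        using low alpha(2) le_conformal_thresholdI[of \<alpha> n "\<lambda>i. s (X i \<omega>)"]
        by (simp add: tau_def k_def del: upt_Suc)
      moreover have "X_new \<omega> \<in> \<X>"
        using measurable_space[OF X_new_measurable \<omega>] by (simp add: space_restrict_space)
      ultimately show "predicted_class T v (w (\<tau> \<omega>)) (X_new \<omega>) = predicted_class T v w0 (X_new \<omega>)"
        using pine_no_counterexamples[OF w_returned[OF \<omega>]]
        by (auto simp: counterexamples_def id_region_def)
    qed
  next
    \<comment> \<open>Monotonicity of \<open>prob\<close> requires the larger event to be
      measurable; a non-measurable set would get measure 0 by default.\<close>
    have X_new: "X_new \<in> borel_measurable M"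
      using X_new_measurable by (simp add: measurable_restrict_space2_iff)
    have [measurable]:
      "(\<lambda>\<omega>. predicted_class T v (w (\<tau> \<omega>)) (X_new \<omega>)) \<in> measurable M (count_space UNIV)"
      "(\<lambda>\<omega>. predicted_class T v w0 (X_new \<omega>)) \<in> measurable M (count_space UNIV)"
      by (intro measurable_predicted_class X_new w_measurable borel_measurable_const)+
    show "?good \<in> sets M"
      by measurable
  qed
  finally show ?thesis .
qed

end
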